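(* Consider any one of the three fully discrete Lagrange multiplier schemes (Euler scheme, Crank--Nicolson scheme, BDF2 scheme) for two-phase Stokes flow described in the context, with external force $\boldsymbol g$. For all $m=0,\dots,M-1$ let $(\boldsymbol u^{m+1},p^{m+1},\boldsymbol X^{m+1},\kappa^{m+1})$ together with $(\lambda_{\mathcal E}^{m+1},\lambda_V^{m+1})\in\mathbb R\times\mathbb R$ be a solution of the chosen scheme (for the BDF2 scheme: of the BDF2 equations for $m=1,\dots,M-1$, the first step $m=0$ being a solution of one step of the Euler or of the Crank--Nicolson scheme). Then for all $m=0,\dots,M-1$: (1) if $\boldsymbol g\equiv 0$, then $\mathcal E^{m+1}\le \mathcal E^{m}\le\dots\le\mathcal E^{0}$; (2) $V^{m+1}=V^{m}=\dots=V^{0}$. Here $\mathcal E^m=\gamma\int_{\Gamma^m}1\,d\mathcal H^{d-1}$ is the discrete interfacial energy and $V^m$ is the volume enclosed by $\Gamma^m$.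
   Context: **Setting.** Let $d\in\{2,3\}$, $\Omega\subset\mathbb R^d$ a bounded Lipschitz domain with polygonal/polyhedral boundary, $\gamma>0$, $\mu_\pm>0$ constants, $T>0$, $M\in\mathbb N$, $\Delta t=T/M$, $t_m=m\Delta t$, $t_{m+\frac12}=(m+\frac12)\Delta t$, and $\boldsymbol g$ an external force ($\mathbb R^d$-valued). $(\cdot,\cdot)$ is the $L^2$-inner product over $\Omega$ (with $A:B=\operatorname{tr}(A^\top B)$ for matrices) and $\mathbb D(\boldsymbol u)=\frac12(\nabla\boldsymbol u+(\nabla\boldsymbol u)^\top)$. **Bulk spaces.** For each $m$ there is a regular triangulation $\mathcal T^m$ of $\Omega$ into open $d$-simplices and finite element spaces $\mathbb U^m\subset H^1_0(\Omega,\mathbb R^d)$, $\widehat{\mathbb P}^m\subset\{f\in L^2(\Omega):\int_\Omega f=0\}$ satisfying the usual inf-sup condition. $I_2^h$ is the standard interpolation operator onto continuous piecewise quadratic vector fields. **Polyhedral surfaces.** All interfaces are closed $(d-1)$-dimensional polyhedral surfaces contained in the interior of $\Omega$, of the form $\Gamma=\bigcup_{j}\overline{\sigma_j}$ with mutually disjoint open $(d-1)$-simplices $\sigma_j$; they are assumed non-degenerate: $\mathcal H^{d-1}(\sigma_j)>0$ for all $j$, and no self-intersections. $\Omega_-$ denotes the region enclosed by $\Gamma$, $\Omega_+$ the exterior part of $\Omega$, $\boldsymbol\nu$ the piecewise constant unit normal pointing into $\Omega_+$. $W(\Gamma)$ is the space of continuous functions on $\Gamma$ that are affine on each $\sigma_j$.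 Set $$\langle u,v\rangle_\Gamma=\int_\Gamma u\cdot v\,d\mathcal H^{d-1},\qquad \langle u,v\rangle_\Gamma^h=\frac1d\sum_j\mathcal H^{d-1}(\sigma_j)\sum_{k=1}^d (u\cdot v)(\boldsymbol q_{j_k}^-),$$ where $\boldsymbol q_{j_1},\dots,\boldsymbol q_{j_d}$ are the vertices of $\sigma_j$ and $u(\boldsymbol q_{j_k}^-)$ is the limit of $u$ from within $\sigma_j$. $\nabla_\Gamma$ is the (elementwise) surface gradient. The discrete viscosity $\mu$ associated with $\Gamma$ is the function, constant on each $o\in\mathcal T^m$, equal to $\mu_-$ if $o\subset\Omega_-$, $\mu_+$ if $o\subset\Omega_+$, and $\frac12(\mu_-+\mu_+)$ if $o\cap\Gamma\ne\emptyset$. All surfaces $\Gamma^{m}$ and predictor surfaces have the same combinatorial structure; a parametrization $\boldsymbol X^m$ of $\Gamma^m$ is regarded as a piecewise affine map on whichever surface is used as the reference, sending vertices to corresponding vertices of $\Gamma^m$. $\Gamma^0$ is given. $\mathcal E^m=\gamma\,\mathcal H^{d-1}(\Gamma^m)$, and $V^m$ is the volume of the region $\Omega_-^m$ enclosed by $\Gamma^m$. **Euler scheme** ($m=0,\dots,M-1$). With $W^m=W(\Gamma^m)$, and $\boldsymbol\nu^m,\mu^m$ associated with $\Gamma^m$, $\boldsymbol g^m=I_2^h\boldsymbol g(t_m)$: find $(\boldsymbol u^{m+1},p^{m+1},\boldsymbol X^{m+1},\kappa^{m+1})\in\mathbb U^m\times\widehat{\mathbb P}^m\times[W^m]^d\times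 W^m$ and $\lambda_{\mathcal E}^{m+1},\lambda_V^{m+1}\in\mathbb R$ such that for all $(\boldsymbol\varphi,q,\eta,\boldsymbol\omega)\in\mathbb U^m\times\widehat{\mathbb P}^m\times W^m\times[W^m]^d$ $$\begin{aligned} 0&=(2\mu^m\mathbb D(\boldsymbol u^{m+1}),\mathbb D(\boldsymbol\varphi))-(p^{m+1},\nabla\cdot\boldsymbol\varphi)-\gamma\langle\kappa^{m+1}\boldsymbol\nu^m,\boldsymbol\varphi\rangle_{\Gamma^m}-(\boldsymbol g^m,\boldsymbol\varphi),\\ 0&=(\nabla\cdot\boldsymbol u^{m+1},q),\\ 0&=\Big\langle\tfrac{\boldsymbol X^{m+1}-\boldsymbol X^m}{\Delta t}\cdot\boldsymbol\nu^m,\eta\Big\rangle^h_{\Gamma^m}-\langle\boldsymbol u^{m+1}\cdot\boldsymbol\nu^m,\eta\rangle_{\Gamma^m}-\lambda_{\mathcal E}^{m+1}\langle\kappa^{m+1},\eta\rangle^h_{\Gamma^m}-\lambda_V^{m+1}\langle1,\eta\rangle^h_{\Gamma^m},\\ 0&=\langle\kappa^{m+1}\boldsymbol\nu^m,\boldsymbol\omega\rangle^h_{\Gamma^m}+\langle\nabla_{\Gamma^m}\boldsymbol X^{m+1},\nabla_{\Gamma^m}\boldsymbol\omega\rangle_{\Gamma^m},\\ 0&=\tfrac{\mathcal E^{m+1}-\mathcal E^m}{\Delta t}+(2\mu^m\mathbb D(\boldsymbol u^{m+1}),\mathbb D(\boldsymbol u^{m+1}))-(\boldsymbol u^{m+1},\boldsymbol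 g^m),\\ 0&=V^{m+1}-V^m, \end{aligned}$$ where $\Gamma^{m+1}=\boldsymbol X^{m+1}(\Gamma^m)$. **Crank--Nicolson scheme** ($m=0,\dots,M-1$). A predictor surface $\widetilde\Gamma=\widetilde\Gamma^{m+\frac12}$ (an approximation of the interface at $t_{m+\frac12}$) is given, with associated $\widetilde{\boldsymbol\nu},\widetilde\mu$, $\widetilde W=W(\widetilde\Gamma)$, and $\widetilde{\boldsymbol g}=I_2^h\boldsymbol g(t_{m+\frac12})$. The quantities $\boldsymbol u^m,p^m,\boldsymbol X^m,\kappa^m,\lambda^m_{\mathcal E},\lambda_V^m$ are given from the previous step (or as initial values), and for each such quantity $f^{m+\frac12}=\frac12(f^{m+1}+f^m)$. Find $(\boldsymbol u^{m+1},p^{m+1},\boldsymbol X^{m+1},\kappa^{m+1})\in\mathbb U^m\times\widehat{\mathbb P}^m\times[\widetilde W]^d\times\widetilde W$ and $\lambda_{\mathcal E}^{m+1},\lambda_V^{m+1}\in\mathbb R$ such that for all $(\boldsymbol\varphi,q,\eta,\boldsymbol\omega)\in\mathbb U^m\times\widehat{\mathbb P}^m\times\widetilde W\times[\widetilde W]^d$ $$\begin{aligned} 0&=(2\widetilde\mu\,\mathbb D(\boldsymbol u^{m+\frac12}),\mathbb D(\boldsymbol\varphi))-(p^{m+\frac12},\nabla\cdot\boldsymbol\varphi)-\gamma\langle\kappa^{m+\frac12}\widetilde{\boldsymbol\nu},\boldsymbol\varphi\rangle_{\widetilde\Gamma}-(\widetilde{\boldsymbol g},\boldsymbol\varphi),\\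 0&=(\nabla\cdot\boldsymbol u^{m+\frac12},q),\\ 0&=\Big\langle\tfrac{\boldsymbol X^{m+1}-\boldsymbol X^m}{\Delta t}\cdot\widetilde{\boldsymbol\nu},\eta\Big\rangle^h_{\widetilde\Gamma}-\langle\boldsymbol u^{m+\frac12}\cdot\widetilde{\boldsymbol\nu},\eta\rangle_{\widetilde\Gamma}-\lambda_{\mathcal E}^{m+\frac12}\langle\kappa^{m+\frac12},\eta\rangle^h_{\widetilde\Gamma}-\lambda_V^{m+\frac12}\langle1,\eta\rangle^h_{\widetilde\Gamma},\\ 0&=\langle\kappa^{m+\frac12}\widetilde{\boldsymbol\nu},\boldsymbol\omega\rangle^h_{\widetilde\Gamma}+\langle\nabla_{\widetilde\Gamma}\boldsymbol X^{m+\frac12},\nabla_{\widetilde\Gamma}\boldsymbol\omega\rangle_{\widetilde\Gamma},\\ 0&=\tfrac{\mathcal E^{m+1}-\mathcal E^m}{\Delta t}+(2\widetilde\mu\,\mathbb D(\boldsymbol u^{m+\frac12}),\mathbb D(\boldsymbol u^{m+\frac12}))-(\boldsymbol u^{m+\frac12},\widetilde{\boldsymbol g}),\\ 0&=V^{m+1}-V^m, \end{aligned}$$ where $\Gamma^{m+1}=\boldsymbol X^{m+1}(\widetilde\Gamma)$. **BDF2 scheme** ($m=1,\dots,M-1$). $\Gamma^{m-1},\Gamma^m$ and a predictor surface $\widetilde\Gamma=\widetilde\Gamma^{m+1}$ (an approximation of the interface at $t_{m+1}$) are given, with associated $\widetilde{\boldsymbol\nu},\widetilde\mu$, $\widetilde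 W=W(\widetilde\Gamma)$, and $\widetilde{\boldsymbol g}=I_2^h\boldsymbol g(t_{m+1})$. Find $(\boldsymbol u^{m+1},p^{m+1},\boldsymbol X^{m+1},\kappa^{m+1})\in\mathbb U^m\times\widehat{\mathbb P}^m\times[\widetilde W]^d\times\widetilde W$ and $\lambda_{\mathcal E}^{m+1},\lambda_V^{m+1}\in\mathbb R$ such that for all $(\boldsymbol\varphi,q,\eta,\boldsymbol\omega)\in\mathbb U^m\times\widehat{\mathbb P}^m\times\widetilde W\times[\widetilde W]^d$ $$\begin{aligned} 0&=(2\widetilde\mu\,\mathbb D(\boldsymbol u^{m+1}),\mathbb D(\boldsymbol\varphi))-(p^{m+1},\nabla\cdot\boldsymbol\varphi)-\gamma\langle\kappa^{m+1}\widetilde{\boldsymbol\nu},\boldsymbol\varphi\rangle_{\widetilde\Gamma}-(\widetilde{\boldsymbol g},\boldsymbol\varphi),\\ 0&=(\nabla\cdot\boldsymbol u^{m+1},q),\\ 0&=\Big\langle\tfrac{3\boldsymbol X^{m+1}-4\boldsymbol X^m+\boldsymbol X^{m-1}}{2\Delta t}\cdot\widetilde{\boldsymbol\nu},\eta\Big\rangle^h_{\widetilde\Gamma}-\langle\boldsymbol u^{m+1}\cdot\widetilde{\boldsymbol\nu},\eta\rangle_{\widetilde\Gamma}-\lambda_{\mathcal E}^{m+1}\langle\kappa^{m+1},\eta\rangle^h_{\widetilde\Gamma}-\lambda_V^{m+1}\langle1,\eta\rangle^h_{\widetilde\Gamma},\\ 0&=\langle\kappa^{m+1}\widetilde{\boldsymbol\nu},\boldsymbol\omega\rangle^h_{\widetilde\Gamma}+\langle\nabla_{\widetilde\Gamma}\boldsymbol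 X^{m+1},\nabla_{\widetilde\Gamma}\boldsymbol\omega\rangle_{\widetilde\Gamma},\\ 0&=\tfrac{3\mathcal E^{m+1}-4\mathcal E^m+\mathcal E^{m-1}}{2\Delta t}+(2\widetilde\mu\,\mathbb D(\boldsymbol u^{m+1}),\mathbb D(\boldsymbol u^{m+1}))-(\boldsymbol u^{m+1},\widetilde{\boldsymbol g}),\\ 0&=3V^{m+1}-4V^m+V^{m-1}, \end{aligned}$$ where $\Gamma^{m+1}=\boldsymbol X^{m+1}(\widetilde\Gamma)$. *)

theory Defs
  imports "HOL-Analysis.Analysis"
begin

section \<open>Domains\<close>

text \<open>Near each boundary point, the domain is the strict epigraph, in some direction \<open>e\<close>, of a
  Lipschitz function that does not depend on the coordinate along \<open>e\<close>.\<close>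

definition lipschitz_domain :: "'a::euclidean_space set \<Rightarrow> bool" where
  "lipschitz_domain \<Omega> \<longleftrightarrow> open \<Omega> \<and> connected \<Omega> \<and> \<Omega> \<noteq> {} \<and>
     (\<forall>x\<in>frontier \<Omega>. \<exists>r>0. \<exists>L e \<phi>. norm e = 1 \<and> L-lipschitz_on UNIV \<phi> \<and>
        (\<forall>y t. \<phi> (y + t *\<^sub>R e) = \<phi> y) \<and> (\<forall>y\<in>ball x r. y \<in> \<Omega> \<longleftrightarrow> \<phi> y < y \<bullet> e))"

definition polyhedral_boundary :: "'a::euclidean_space set \<Rightarrow> bool" where
  "polyhedral_boundary \<Omega> \<longleftrightarrow>
     (\<exists>F. finite F \<and> (\<forall>f\<in>F. polytope f \<and> aff_dim f = int DIM('a) - 1) \<and> frontier \<Omega> = \<Union>F)"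


section \<open>Lebesgue and Sobolev spaces\<close>

text \<open>Elements of these spaces are represented by functions on the whole space; only their values
  on \<open>\<Omega>\<close> (or its closure) matter.\<close>

definition L2 :: "'a::euclidean_space set \<Rightarrow> ('a \<Rightarrow> 'b::euclidean_space) \<Rightarrow> bool" where
  "L2 \<Omega> f \<longleftrightarrow> f \<in> borel_measurable (lebesgue_on \<Omega>) \<and> integrable (lebesgue_on \<Omega>) (\<lambda>x. (norm (f x))\<^sup>2)"

text \<open>For matrices, the library inner product is the Frobenius product \<open>tr (A\<^sup>T B)\<close>.\<close>

definition l2_inner :: "'a::euclidean_space set \<Rightarrow> ('a \<Rightarrow> 'b::euclidean_space) \<Rightarrow> ('a \<Rightarrow> 'b) \<Rightarrow> real" where
  "l2_inner \<Omega> f g = (\<integral>x. f x \<bullet> g x \<partial>lebesgue_on \<Omega>)"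

definition partial_deriv :: "'d::finite \<Rightarrow> (real^'d \<Rightarrow> real) \<Rightarrow> real^'d \<Rightarrow> real" where
  "partial_deriv i f x = frechet_derivative f (at x) (axis i 1)"

primrec times_differentiable :: "nat \<Rightarrow> (real^'d \<Rightarrow> real) \<Rightarrow> bool" where
  "times_differentiable 0 f \<longleftrightarrow> continuous_on UNIV f"
| "times_differentiable (Suc n) f \<longleftrightarrow>
     f differentiable_on UNIV \<and> (\<forall>i. times_differentiable n (partial_deriv i f))"

definition test_function :: "(real^'d) set \<Rightarrow> (real^'d \<Rightarrow> real) \<Rightarrow> bool" where
  "test_function \<Omega> \<phi> \<longleftrightarrow> (\<forall>n. times_differentiable n \<phi>) \<and>
     compact (closure {x. \<phi> x \<noteq> 0}) \<and> closure {x. \<phi> x \<noteq> 0} \<subseteq> \<Omega>"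

definition has_weak_partial ::
  "(real^'d) set \<Rightarrow> (real^'d \<Rightarrow> real) \<Rightarrow> 'd \<Rightarrow> (real^'d \<Rightarrow> real) \<Rightarrow> bool" where
  "has_weak_partial \<Omega> f i h \<longleftrightarrow> L2 \<Omega> h \<and>
     (\<forall>\<phi>. test_function \<Omega> \<phi> \<longrightarrow> l2_inner \<Omega> f (partial_deriv i \<phi>) = - l2_inner \<Omega> h \<phi>)"

definition weak_partial :: "(real^'d) set \<Rightarrow> 'd \<Rightarrow> (real^'d \<Rightarrow> real) \<Rightarrow> real^'d \<Rightarrow> real" where
  "weak_partial \<Omega> i f = (SOME h. has_weak_partial \<Omega> f i h)"

definition H1 :: "(real^'d) set \<Rightarrow> (real^'d \<Rightarrow> real^'d) \<Rightarrow> bool" where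
  "H1 \<Omega> u \<longleftrightarrow> L2 \<Omega> u \<and> (\<forall>i j. \<exists>h. has_weak_partial \<Omega> (\<lambda>x. u x $ i) j h)"

definition weak_grad :: "(real^'d) set \<Rightarrow> (real^'d \<Rightarrow> real^'d) \<Rightarrow> real^'d \<Rightarrow> real^'d^'d" where
  "weak_grad \<Omega> u x = (\<chi> i j. weak_partial \<Omega> j (\<lambda>y. u y $ i) x)"

definition weak_div :: "(real^'d) set \<Rightarrow> (real^'d \<Rightarrow> real^'d) \<Rightarrow> real^'d \<Rightarrow> real" where
  "weak_div \<Omega> u x = trace (weak_grad \<Omega> u x)"

definition sym_grad :: "(real^'d) set \<Rightarrow> (real^'d \<Rightarrow> real^'d) \<Rightarrow> real^'d \<Rightarrow> real^'d^'d" where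
  "sym_grad \<Omega> u x = (1/2) *\<^sub>R (weak_grad \<Omega> u x + transpose (weak_grad \<Omega> u x))"

definition h1_norm :: "(real^'d) set \<Rightarrow> (real^'d \<Rightarrow> real^'d) \<Rightarrow> real" where
  "h1_norm \<Omega> u = sqrt (l2_inner \<Omega> u u + l2_inner \<Omega> (weak_grad \<Omega> u) (weak_grad \<Omega> u))"

definition H10 :: "(real^'d) set \<Rightarrow> (real^'d \<Rightarrow> real^'d) \<Rightarrow> bool" where
  "H10 \<Omega> u \<longleftrightarrow> H1 \<Omega> u \<and>
     (\<exists>\<phi>. (\<forall>n i. test_function \<Omega> (\<lambda>x. \<phi> n x $ i)) \<and>
          (\<lambda>n. h1_norm \<Omega> (\<lambda>x. \<phi> n x - u x)) \<longlonglongrightarrow> 0)"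

definition L2_0 :: "'a::euclidean_space set \<Rightarrow> ('a \<Rightarrow> real) \<Rightarrow> bool" where
  "L2_0 \<Omega> f \<longleftrightarrow> L2 \<Omega> f \<and> (\<integral>x. f x \<partial>lebesgue_on \<Omega>) = 0"


section \<open>Bulk finite elements\<close>

definition open_simplex :: "'a::euclidean_space set \<Rightarrow> bool" where
  "open_simplex S \<longleftrightarrow>
     (\<exists>C. \<not> affine_dependent C \<and> card C = DIM('a) + 1 \<and> S = interior (convex hull C))"

definition regular_triangulation :: "'a::euclidean_space set \<Rightarrow> 'a set set \<Rightarrow> bool" where
  "regular_triangulation \<Omega> \<T> \<longleftrightarrow> (\<forall>S\<in>\<T>. open_simplex S) \<and> finite \<T> \<and> pairwise disjnt \<T> \<and>
     triangulation (closure ` \<T>) \<and> closure \<Omega> = \<Union>(closure ` \<T>)"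

definition polynomial_on :: "nat \<Rightarrow> (real^'d) set \<Rightarrow> (real^'d \<Rightarrow> real) \<Rightarrow> bool" where
  "polynomial_on k S f \<longleftrightarrow>
     (\<exists>c. \<forall>x\<in>S. f x = (\<Sum>\<alpha> | (\<Sum>i\<in>UNIV. \<alpha> i) \<le> k. c \<alpha> * (\<Prod>i\<in>UNIV. x $ i ^ \<alpha> i)))"

definition linear_space :: "('a \<Rightarrow> 'b::real_vector) set \<Rightarrow> bool" where
  "linear_space V \<longleftrightarrow> (\<lambda>x. 0) \<in> V \<and> (\<forall>f\<in>V. \<forall>g\<in>V. (\<lambda>x. f x + g x) \<in> V) \<and>
     (\<forall>c. \<forall>f\<in>V. (\<lambda>x. c *\<^sub>R f x) \<in> V)"

definition velocity_space :: "(real^'d) set \<Rightarrow> (real^'d) set set \<Rightarrow> (real^'d \<Rightarrow> real^'d) set \<Rightarrow> bool" where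
  "velocity_space \<Omega> \<T> U \<longleftrightarrow> linear_space U \<and>
     (\<forall>u\<in>U. H10 \<Omega> u \<and> continuous_on (closure \<Omega>) u) \<and>
     (\<exists>k. \<forall>u\<in>U. \<forall>S\<in>\<T>. \<forall>i. polynomial_on k S (\<lambda>x. u x $ i))"

definition pressure_space :: "(real^'d) set \<Rightarrow> (real^'d) set set \<Rightarrow> (real^'d \<Rightarrow> real) set \<Rightarrow> bool" where
  "pressure_space \<Omega> \<T> P \<longleftrightarrow> linear_space P \<and> (\<forall>p\<in>P. L2_0 \<Omega> p) \<and>
     (\<exists>k. \<forall>p\<in>P. \<forall>S\<in>\<T>. polynomial_on k S p)"

text \<open>Extended reals make the supremum over an empty set equal to \<open>-\<infinity>\<close>.\<close>

definition inf_sup_stable ::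
  "(real^'d) set \<Rightarrow> (real^'d \<Rightarrow> real^'d) set \<Rightarrow> (real^'d \<Rightarrow> real) set \<Rightarrow> bool" where
  "inf_sup_stable \<Omega> U P \<longleftrightarrow> (\<exists>c>0. ereal c \<le>
     (INF q\<in>{q\<in>P. l2_inner \<Omega> q q \<noteq> 0}. SUP \<phi>\<in>{\<phi>\<in>U. h1_norm \<Omega> \<phi> \<noteq> 0}.
        ereal (l2_inner \<Omega> q (weak_div \<Omega> \<phi>) / (h1_norm \<Omega> \<phi> * sqrt (l2_inner \<Omega> q q)))))"

definition barycentric :: "'a::euclidean_space set \<Rightarrow> 'a \<Rightarrow> 'a \<Rightarrow> real" where
  "barycentric C x = (THE l. (\<forall>a. a \<notin> C \<longrightarrow> l a = 0) \<and> sum l C = 1 \<and> (\<Sum>a\<in>C. l a *\<^sub>R a) = x)"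

text \<open>Quadratic Lagrange interpolation: the nodes are the vertices and edge midpoints, with nodal
  basis functions \<open>\<lambda>\<^sub>a (2 \<lambda>\<^sub>a - 1)\<close> and \<open>4 \<lambda>\<^sub>a \<lambda>\<^sub>b\<close>. The double sum visits
  each edge twice. The result on a common face does not depend on the chosen simplex.\<close>

definition quadratic_interpolant ::
  "'a::euclidean_space set set \<Rightarrow> ('a \<Rightarrow> 'b::real_vector) \<Rightarrow> 'a \<Rightarrow> 'b" where
  "quadratic_interpolant \<T> g x =
     (let S = (SOME S. S \<in> \<T> \<and> x \<in> closure S);
          C = {a. a extreme_point_of closure S};
          l = barycentric C x
      in (\<Sum>a\<in>C. (l a * (2 * l a - 1)) *\<^sub>R g a) +
         (\<Sum>a\<in>C. \<Sum>b\<in>C - {a}. (2 * l a * l b) *\<^sub>R g (midpoint a b)))"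


section \<open>Hausdorff measure\<close>

definition hausdorff_premeasure :: "nat \<Rightarrow> real \<Rightarrow> 'a::metric_space set \<Rightarrow> ennreal" where
  "hausdorff_premeasure k \<delta> A =
     (INF E\<in>{E :: nat \<Rightarrow> 'a set. A \<subseteq> (\<Union>i. E i) \<and> (\<forall>i. bounded (E i) \<and> diameter (E i) \<le> \<delta>)}.
        \<Sum>i. if E i = {} then 0 else ennreal (unit_ball_vol (real k) * (diameter (E i) / 2) ^ k))"

definition hausdorff_outer :: "nat \<Rightarrow> 'a::metric_space set \<Rightarrow> ennreal" where
  "hausdorff_outer k A = (SUP \<delta>\<in>{0<..}. hausdorff_premeasure k \<delta> A)"

text \<open>The outer measure is a metric outer measure, hence countably additive on the Borel sets, so
  \<open>measure_of\<close> returns its restriction to them rather than the zero measure.\<close>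

definition hausdorff_measure :: "nat \<Rightarrow> 'a::metric_space measure" where
  "hausdorff_measure k = measure_of UNIV (sets borel) (hausdorff_outer k)"

abbreviation surface_measure :: "(real^'d) measure" where
  "surface_measure \<equiv> hausdorff_measure (CARD('d) - 1)"


section \<open>Polyhedral surfaces\<close>

text \<open>The combinatorial structure is the set \<open>K\<close> of vertex sets of the simplices, over abstract
  vertices of type \<^typ>\<open>'v\<close>; it is shared by all surfaces. A surface is given by the positions
  \<open>Y\<close> of its vertices.\<close>

definition facet :: "('v \<Rightarrow> real^'d) \<Rightarrow> 'v set \<Rightarrow> (real^'d) set" where
  "facet Y s = rel_interior (convex hull (Y ` s))"

definition surface :: "'v set set \<Rightarrow> ('v \<Rightarrow> real^'d) \<Rightarrow> (real^'d) set" where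
  "surface K Y = (\<Union>s\<in>K. closure (facet Y s))"

definition inner_region :: "'v set set \<Rightarrow> ('v \<Rightarrow> real^'d) \<Rightarrow> (real^'d) set" where
  "inner_region K Y = inside (surface K Y)"

definition outer_region :: "(real^'d) set \<Rightarrow> 'v set set \<Rightarrow> ('v \<Rightarrow> real^'d) \<Rightarrow> (real^'d) set" where
  "outer_region \<Omega> K Y = \<Omega> \<inter> outside (surface K Y)"

definition outward_normal ::
  "(real^'d) set \<Rightarrow> 'v set set \<Rightarrow> ('v \<Rightarrow> real^'d) \<Rightarrow> 'v set \<Rightarrow> real^'d \<Rightarrow> bool" where
  "outward_normal \<Omega> K Y s n \<longleftrightarrow> norm n = 1 \<and>
     (\<forall>x\<in>facet Y s. \<forall>y\<in>facet Y s. n \<bullet> (x - y) = 0) \<and>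
     (\<forall>x\<in>facet Y s. \<forall>\<^sub>F \<epsilon> in at_right 0. x + \<epsilon> *\<^sub>R n \<in> outer_region \<Omega> K Y)"

text \<open>Closedness and absence of self-intersections: simplices meet exactly in their
  common combinatorial faces, and the surface is a topological manifold without boundary.
  The outward normal exists for instance whenever the surface is connected; the condition excludes
  nested components, for which ``the enclosed region'' would be ambiguous.\<close>

definition polyhedral_surface :: "(real^'d) set \<Rightarrow> 'v set set \<Rightarrow> ('v \<Rightarrow> real^'d) \<Rightarrow> bool" where
  "polyhedral_surface \<Omega> K Y \<longleftrightarrow> finite K \<and> K \<noteq> {} \<and> surface K Y \<subseteq> \<Omega> \<and>
     (\<forall>s\<in>K. card s = CARD('d) \<and> (int CARD('d) - 1) simplex (convex hull (Y ` s)) \<and>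
        0 < measure surface_measure (facet Y s)) \<and>
     (\<forall>s\<in>K. \<forall>t\<in>K. convex hull (Y ` s) \<inter> convex hull (Y ` t) = convex hull (Y ` (s \<inter> t))) \<and>
     (\<forall>x\<in>surface K Y. \<exists>N k. openin (top_of_set (surface K Y)) N \<and> x \<in> N \<and>
        N homeomorphic {y::real^'d. y $ k = 0}) \<and>
     (\<forall>s\<in>K. \<exists>n. outward_normal \<Omega> K Y s n)"

text \<open>Elementwise defined fields are set to zero off the open simplices, that is, on a null set of
  the surface.\<close>

definition surface_normal ::
  "(real^'d) set \<Rightarrow> 'v set set \<Rightarrow> ('v \<Rightarrow> real^'d) \<Rightarrow> real^'d \<Rightarrow> real^'d" where
  "surface_normal \<Omega> K Y x =
     (\<Sum>s\<in>K. indicator (facet Y s) x *\<^sub>R (THE n. outward_normal \<Omega> K Y s n))"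

text \<open>With values in \<^typ>\<open>real\<close> this is \<open>W(\<Gamma>)\<close>, with values in \<^typ>\<open>real^'d\<close> it is \<open>[W(\<Gamma>)]\<^sup>d\<close>.\<close>

definition W :: "'v set set \<Rightarrow> ('v \<Rightarrow> real^'d) \<Rightarrow> (real^'d \<Rightarrow> 'b::euclidean_space) set" where
  "W K Y = {w. continuous_on (surface K Y) w \<and>
     (\<forall>s\<in>K. \<exists>A b. linear A \<and> (\<forall>x\<in>facet Y s. w x = A x + b))}"

text \<open>The piecewise affine function on the surface with vertices \<open>R\<close> that has the nodal values \<open>f\<close>
  (unique on the surface). Data attached to another surface is regarded as a function on the
  reference surface by identifying corresponding vertices.\<close>

definition regard :: "'v set set \<Rightarrow> ('v \<Rightarrow> real^'d) \<Rightarrow> ('v \<Rightarrow> 'b) \<Rightarrow> real^'d \<Rightarrow> 'b::euclidean_space" where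
  "regard K R f = (SOME w. w \<in> W K R \<and> (\<forall>v\<in>\<Union>K. w (R v) = f v))"

definition surf_inner ::
  "'v set set \<Rightarrow> ('v \<Rightarrow> real^'d) \<Rightarrow> (real^'d \<Rightarrow> 'b::euclidean_space) \<Rightarrow> (real^'d \<Rightarrow> 'b) \<Rightarrow> real" where
  "surf_inner K Y f g = (LINT x:surface K Y|surface_measure. f x \<bullet> g x)"

definition surf_inner_h ::
  "'v set set \<Rightarrow> ('v \<Rightarrow> real^'d) \<Rightarrow> (real^'d \<Rightarrow> 'b::euclidean_space) \<Rightarrow> (real^'d \<Rightarrow> 'b) \<Rightarrow> real" where
  "surf_inner_h K Y f g = 1 / real CARD('d) *
     (\<Sum>s\<in>K. measure surface_measure (facet Y s) *
        (\<Sum>v\<in>s. Lim (at (Y v) within facet Y s) (\<lambda>x. f x \<bullet> g x)))"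

definition tangential_grad :: "'a::euclidean_space set \<Rightarrow> ('a \<Rightarrow> real) \<Rightarrow> 'a \<Rightarrow> 'a" where
  "tangential_grad S f x =
     (THE v. v \<in> span ((\<lambda>y. y - x) ` S) \<and> (f has_derivative (\<lambda>h. v \<bullet> h)) (at x within S))"

text \<open>Row \<open>i\<close> of the matrix is the surface gradient of component \<open>i\<close>.\<close>

definition surf_grad ::
  "'v set set \<Rightarrow> ('v \<Rightarrow> real^'d) \<Rightarrow> (real^'d \<Rightarrow> real^'d) \<Rightarrow> real^'d \<Rightarrow> real^'d^'d" where
  "surf_grad K Y w x =
     (\<Sum>s\<in>K. indicator (facet Y s) x *\<^sub>R (\<chi> i. tangential_grad (facet Y s) (\<lambda>y. w y $ i) x))"

definition energy :: "real \<Rightarrow> 'v set set \<Rightarrow> ('v \<Rightarrow> real^'d) \<Rightarrow> real" where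
  "energy \<gamma> K Y = \<gamma> * measure surface_measure (surface K Y)"

definition volume :: "'v set set \<Rightarrow> ('v \<Rightarrow> real^'d) \<Rightarrow> real" where
  "volume K Y = measure lebesgue (inner_region K Y)"


section \<open>The three schemes\<close>

record ('v, 'd::finite) stokes_problem =
  domain :: "(real^'d) set"
  tension :: real
  visc_minus :: real
  visc_plus :: real
  final_time :: real
  num_steps :: nat
  force :: "real \<Rightarrow> real^'d \<Rightarrow> real^'d"
  mesh :: "nat \<Rightarrow> (real^'d) set set"
  vel_space :: "nat \<Rightarrow> (real^'d \<Rightarrow> real^'d) set"
  pres_space :: "nat \<Rightarrow> (real^'d \<Rightarrow> real) set"
  surf_complex :: "'v set set"

text \<open>\<open>nodes m\<close> are the vertex positions of \<open>\<Gamma>\<^sup>m\<close>, and \<open>predictor m\<close> those of the predictor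
  surface used in the step from \<open>m\<close> to \<open>m + 1\<close>. The functions \<open>param (m + 1)\<close> and
  \<open>curv (m + 1)\<close> live on the reference surface of that step.\<close>

record ('v, 'd::finite) stokes_solution =
  nodes :: "nat \<Rightarrow> 'v \<Rightarrow> real^'d"
  predictor :: "nat \<Rightarrow> 'v \<Rightarrow> real^'d"
  vel :: "nat \<Rightarrow> real^'d \<Rightarrow> real^'d"
  pres :: "nat \<Rightarrow> real^'d \<Rightarrow> real"
  param :: "nat \<Rightarrow> real^'d \<Rightarrow> real^'d"
  curv :: "nat \<Rightarrow> real^'d \<Rightarrow> real"
  lamE :: "nat \<Rightarrow> real"
  lamV :: "nat \<Rightarrow> real"

definition time_step :: "('v, 'd::finite) stokes_problem \<Rightarrow> real" where
  "time_step Pb = final_time Pb / real (num_steps Pb)"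

definition discrete_energy :: "('v, 'd::finite) stokes_problem \<Rightarrow> ('v, 'd) stokes_solution \<Rightarrow> nat \<Rightarrow> real" where
  "discrete_energy Pb S m = energy (tension Pb) (surf_complex Pb) (nodes S m)"

definition discrete_volume :: "('v, 'd::finite) stokes_problem \<Rightarrow> ('v, 'd) stokes_solution \<Rightarrow> nat \<Rightarrow> real" where
  "discrete_volume Pb S m = volume (surf_complex Pb) (nodes S m)"

text \<open>An element inside \<open>\<Omega>\<close> that lies in neither region meets the surface, being connected.\<close>

definition element_viscosity ::
  "('v, 'd::finite) stokes_problem \<Rightarrow> ('v \<Rightarrow> real^'d) \<Rightarrow> (real^'d) set \<Rightarrow> real" where
  "element_viscosity Pb R S =
     (if S \<subseteq> inner_region (surf_complex Pb) R then visc_minus Pb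
      else if S \<subseteq> outer_region (domain Pb) (surf_complex Pb) R then visc_plus Pb
      else (visc_minus Pb + visc_plus Pb) / 2)"

definition viscosity :: "('v, 'd::finite) stokes_problem \<Rightarrow> nat \<Rightarrow> ('v \<Rightarrow> real^'d) \<Rightarrow> real^'d \<Rightarrow> real" where
  "viscosity Pb m R x = (\<Sum>S\<in>mesh Pb m. indicator S x * element_viscosity Pb R S)"

definition dissipation ::
  "('v, 'd::finite) stokes_problem \<Rightarrow> nat \<Rightarrow> ('v \<Rightarrow> real^'d) \<Rightarrow> (real^'d \<Rightarrow> real^'d) \<Rightarrow> (real^'d \<Rightarrow> real^'d) \<Rightarrow> real" where
  "dissipation Pb m R u \<phi> = l2_inner (domain Pb)
     (\<lambda>x. (2 * viscosity Pb m R x) *\<^sub>R sym_grad (domain Pb) u x) (sym_grad (domain Pb) \<phi>)"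

definition interp_force :: "('v, 'd::finite) stokes_problem \<Rightarrow> nat \<Rightarrow> real \<Rightarrow> real^'d \<Rightarrow> real^'d" where
  "interp_force Pb m t = quadratic_interpolant (mesh Pb m) (force Pb t)"

text \<open>The four variational equations common to the schemes, on the reference surface with vertices
  \<open>R\<close>: momentum balance, incompressibility, kinematic condition (with discrete interface velocity
  \<open>dX\<close>) and curvature identity.\<close>

definition variational_equations ::
  "('v, 'd::finite) stokes_problem \<Rightarrow> nat \<Rightarrow> ('v \<Rightarrow> real^'d) \<Rightarrow> (real^'d \<Rightarrow> real^'d) \<Rightarrow>
   (real^'d \<Rightarrow> real^'d) \<Rightarrow> (real^'d \<Rightarrow> real) \<Rightarrow> (real^'d \<Rightarrow> real^'d) \<Rightarrow> (real^'d \<Rightarrow> real^'d) \<Rightarrow>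
   (real^'d \<Rightarrow> real) \<Rightarrow> real \<Rightarrow> real \<Rightarrow> bool" where
  "variational_equations Pb m R g u p dX X \<kappa> lE lV \<longleftrightarrow>
     (let \<Omega> = domain Pb; K = surf_complex Pb; \<nu> = surface_normal \<Omega> K R in
       (\<forall>\<phi>\<in>vel_space Pb m.
          0 = dissipation Pb m R u \<phi> - l2_inner \<Omega> p (weak_div \<Omega> \<phi>)
              - tension Pb * surf_inner K R (\<lambda>x. \<kappa> x *\<^sub>R \<nu> x) \<phi> - l2_inner \<Omega> g \<phi>) \<and>
       (\<forall>q\<in>pres_space Pb m. 0 = l2_inner \<Omega> (weak_div \<Omega> u) q) \<and>
       (\<forall>\<eta>\<in>W K R.
          0 = surf_inner_h K R (\<lambda>x. dX x \<bullet> \<nu> x) \<eta> - surf_inner K R (\<lambda>x. u x \<bullet> \<nu> x) \<eta>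
              - lE * surf_inner_h K R \<kappa> \<eta> - lV * surf_inner_h K R (\<lambda>x. 1) \<eta>) \<and>
       (\<forall>\<omega>\<in>W K R.
          0 = surf_inner_h K R (\<lambda>x. \<kappa> x *\<^sub>R \<nu> x) \<omega>
              + surf_inner K R (surf_grad K R X) (surf_grad K R \<omega>)))"

text \<open>The unknowns lie in their spaces, and \<open>\<Gamma>\<^sup>m\<^sup>+\<^sup>1\<close> is the image of the reference surface.\<close>

definition step_unknowns ::
  "('v, 'd::finite) stokes_problem \<Rightarrow> ('v, 'd) stokes_solution \<Rightarrow> nat \<Rightarrow> ('v \<Rightarrow> real^'d) \<Rightarrow> bool" where
  "step_unknowns Pb S m R \<longleftrightarrow>
     vel S (Suc m) \<in> vel_space Pb m \<and> pres S (Suc m) \<in> pres_space Pb m \<and>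
     param S (Suc m) \<in> W (surf_complex Pb) R \<and> curv S (Suc m) \<in> W (surf_complex Pb) R \<and>
     (\<forall>v\<in>\<Union>(surf_complex Pb). nodes S (Suc m) v = param S (Suc m) (R v))"

definition euler_step :: "('v, 'd::finite) stokes_problem \<Rightarrow> ('v, 'd) stokes_solution \<Rightarrow> nat \<Rightarrow> bool" where
  "euler_step Pb S m \<longleftrightarrow>
     (let \<Omega> = domain Pb; R = nodes S m; \<tau> = time_step Pb;
          g = interp_force Pb m (real m * \<tau>);
          X = regard (surf_complex Pb) R (nodes S m);
          E = discrete_energy Pb S; V = discrete_volume Pb S; u = vel S (Suc m)
      in step_unknowns Pb S m R \<and>
         variational_equations Pb m R g u (pres S (Suc m))
           (\<lambda>x. (param S (Suc m) x - X x) /\<^sub>R \<tau>) (param S (Suc m)) (curv S (Suc m))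
           (lamE S (Suc m)) (lamV S (Suc m)) \<and>
         0 = (E (Suc m) - E m) / \<tau> + dissipation Pb m R u u - l2_inner \<Omega> u g \<and>
         0 = V (Suc m) - V m)"

text \<open>For \<open>m = 0\<close> the curvature \<open>\<kappa>\<^sup>m\<close> is given on \<open>\<Gamma>\<^sup>0\<close>; afterwards it lives on the
  predictor surface of the preceding step.\<close>

definition crank_nicolson_step ::
  "('v, 'd::finite) stokes_problem \<Rightarrow> ('v, 'd) stokes_solution \<Rightarrow> nat \<Rightarrow> bool" where
  "crank_nicolson_step Pb S m \<longleftrightarrow>
     (let \<Omega> = domain Pb; K = surf_complex Pb; R = predictor S m; \<tau> = time_step Pb;
          g = interp_force Pb m ((real m + 1/2) * \<tau>);
          X = regard K R (nodes S m);
          R' = (if m = 0 then nodes S 0 else predictor S (m - 1));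
          \<kappa> = regard K R (\<lambda>v. curv S m (R' v));
          E = discrete_energy Pb S; V = discrete_volume Pb S;
          u = (\<lambda>x. (vel S (Suc m) x + vel S m x) /\<^sub>R 2)
      in polyhedral_surface \<Omega> K R \<and> step_unknowns Pb S m R \<and>
         variational_equations Pb m R g u
           (\<lambda>x. (pres S (Suc m) x + pres S m x) / 2)
           (\<lambda>x. (param S (Suc m) x - X x) /\<^sub>R \<tau>)
           (\<lambda>x. (param S (Suc m) x + X x) /\<^sub>R 2)
           (\<lambda>x. (curv S (Suc m) x + \<kappa> x) / 2)
           ((lamE S (Suc m) + lamE S m) / 2) ((lamV S (Suc m) + lamV S m) / 2) \<and>
         0 = (E (Suc m) - E m) / \<tau> + dissipation Pb m R u u - l2_inner \<Omega> u g \<and>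
         0 = V (Suc m) - V m)"

definition initial_values :: "('v, 'd::finite) stokes_problem \<Rightarrow> ('v, 'd) stokes_solution \<Rightarrow> bool" where
  "initial_values Pb S \<longleftrightarrow>
     H10 (domain Pb) (vel S 0) \<and> continuous_on (closure (domain Pb)) (vel S 0) \<and>
     L2_0 (domain Pb) (pres S 0) \<and> curv S 0 \<in> W (surf_complex Pb) (nodes S 0)"

definition bdf2_step :: "('v, 'd::finite) stokes_problem \<Rightarrow> ('v, 'd) stokes_solution \<Rightarrow> nat \<Rightarrow> bool" where
  "bdf2_step Pb S m \<longleftrightarrow>
     (let \<Omega> = domain Pb; K = surf_complex Pb; R = predictor S m; \<tau> = time_step Pb;
          g = interp_force Pb m (real (Suc m) * \<tau>);
          X = regard K R (nodes S m); Xold = regard K R (nodes S (m - 1));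
          E = discrete_energy Pb S; V = discrete_volume Pb S; u = vel S (Suc m)
      in polyhedral_surface \<Omega> K R \<and> step_unknowns Pb S m R \<and>
         variational_equations Pb m R g u (pres S (Suc m))
           (\<lambda>x. (3 *\<^sub>R param S (Suc m) x - 4 *\<^sub>R X x + Xold x) /\<^sub>R (2 * \<tau>))
           (param S (Suc m)) (curv S (Suc m)) (lamE S (Suc m)) (lamV S (Suc m)) \<and>
         0 = (3 * E (Suc m) - 4 * E m + E (m - 1)) / (2 * \<tau>)
             + dissipation Pb m R u u - l2_inner \<Omega> u g \<and>
         0 = 3 * V (Suc m) - 4 * V m + V (m - 1))"

datatype scheme = Euler | Crank_Nicolson | BDF2

definition scheme_solution ::
  "scheme \<Rightarrow> ('v, 'd::finite) stokes_problem \<Rightarrow> ('v, 'd) stokes_solution \<Rightarrow> bool" where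
  "scheme_solution sch Pb S \<longleftrightarrow>
     (case sch of
        Euler \<Rightarrow> \<forall>m<num_steps Pb. euler_step Pb S m
      | Crank_Nicolson \<Rightarrow> initial_values Pb S \<and> (\<forall>m<num_steps Pb. crank_nicolson_step Pb S m)
      | BDF2 \<Rightarrow> (euler_step Pb S 0 \<or> initial_values Pb S \<and> crank_nicolson_step Pb S 0) \<and>
          (\<forall>m\<in>{1..<num_steps Pb}. bdf2_step Pb S m))"

definition stokes_setting :: "('v, 'd::finite) stokes_problem \<Rightarrow> bool" where
  "stokes_setting Pb \<longleftrightarrow> CARD('d) \<in> {2, 3} \<and>
     bounded (domain Pb) \<and> lipschitz_domain (domain Pb) \<and> polyhedral_boundary (domain Pb) \<and>
     0 < tension Pb \<and> 0 < visc_minus Pb \<and> 0 < visc_plus Pb \<and>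
     0 < final_time Pb \<and> 0 < num_steps Pb \<and>
     (\<forall>m<num_steps Pb. regular_triangulation (domain Pb) (mesh Pb m) \<and>
        velocity_space (domain Pb) (mesh Pb m) (vel_space Pb m) \<and>
        pressure_space (domain Pb) (mesh Pb m) (pres_space Pb m) \<and>
        inf_sup_stable (domain Pb) (vel_space Pb m) (pres_space Pb m))"

end

theory Submission
  imports Defs
begin

text \<open>With zero force the energy equation of each scheme makes the discrete time derivative of the
  energy equal to minus a viscous dissipation, which is nonnegative since the viscosity is. For BDF2,
  \<open>3 E\<^sub>m\<^sub>+\<^sub>1 - 4 E\<^sub>m + E\<^sub>m\<^sub>-\<^sub>1 \<le> 0\<close> means \<open>3 (E\<^sub>m\<^sub>+\<^sub>1 - E\<^sub>m) \<le> E\<^sub>m - E\<^sub>m\<^sub>-\<^sub>1\<close>, so monotonicity propagates from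
  the first step by induction, and likewise for the volume.\<close>

text \<open>All interpolation nodes, the vertices and edge midpoints of a mesh simplex, lie in its
  closure by convexity and hence in \<open>closure \<Omega>\<close>. They may lie on the boundary,
  so \<open>g\<close> has to vanish on the closure.\<close>

lemma quadratic_interpolant_eq_0:
  assumes tri: "regular_triangulation \<Omega> \<T>"
    and g0: "\<And>y. y \<in> closure \<Omega> \<Longrightarrow> g y = 0"
    and x: "x \<in> closure \<Omega>"
  shows "quadratic_interpolant \<T> g x = 0"
proof -
  define S where "S = (SOME S. S \<in> \<T> \<and> x \<in> closure S)"
  define C where "C = {a. a extreme_point_of closure S}"
  have "\<exists>S. S \<in> \<T> \<and> x \<in> closure S"
    using tri x unfolding regular_triangulation_def by auto
  then have S: "S \<in> \<T>"
    unfolding S_def by (rule someI2_ex) simp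
  then have sub: "closure S \<subseteq> closure \<Omega>"
    using tri unfolding regular_triangulation_def by auto
  have "open_simplex S"
    using S tri unfolding regular_triangulation_def by blast
  then have "convex (closure S)"
    unfolding open_simplex_def by (auto intro!: convex_closure convex_interior)
  moreover have "C \<subseteq> closure S"
    unfolding C_def extreme_point_of_def by auto
  ultimately have "a \<in> closure S" "midpoint a b \<in> closure S" if "a \<in> C" "b \<in> C" for a b
    using that closed_segment_subset[of a "closure S" b] midpoint_in_closed_segment[of a b] by blast+
  then have "g a = 0" "g (midpoint a b) = 0" if "a \<in> C" "b \<in> C" for a b
    using that sub g0 by blast+
  then show ?thesis
    unfolding quadratic_interpolant_def Let_def S_def[symmetric] C_def[symmetric]
    by (simp add: sum.neutral)
qed

lemma viscosity_nonneg:
  assumes "stokes_setting Pb"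
  shows "0 \<le> viscosity Pb m R x"
  using assms unfolding viscosity_def stokes_setting_def element_viscosity_def
  by (auto intro!: sum_nonneg)

text \<open>The integrand is twice the viscosity times a squared Frobenius norm. If it were not
  integrable, the Bochner integral would be 0 by default, so the sign is right in every
  case.\<close>

lemma dissipation_nonneg:
  assumes "stokes_setting Pb"
  shows "0 \<le> dissipation Pb m R u u"
  unfolding dissipation_def l2_inner_def
  using viscosity_nonneg[OF assms] by (auto intro!: integral_nonneg_AE)

lemma l2_inner_interp_force_eq_0:
  assumes "stokes_setting Pb" and "m < num_steps Pb"
    and "\<And>x. x \<in> closure (domain Pb) \<Longrightarrow> force Pb t x = 0"
  shows "l2_inner (domain Pb) u (interp_force Pb m t) = 0"
proof -
  have "regular_triangulation (domain Pb) (mesh Pb m)"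
    using assms(1,2) unfolding stokes_setting_def by blast
  then have "interp_force Pb m t x = 0" if "x \<in> domain Pb" for x
    unfolding interp_force_def
    using that closure_subset[of "domain Pb"] by (auto intro!: quadratic_interpolant_eq_0 assms(3))
  then have "l2_inner (domain Pb) u (interp_force Pb m t) = (\<integral>x. 0 \<partial>lebesgue_on (domain Pb))"
    unfolding l2_inner_def by (intro Bochner_Integration.integral_cong) auto
  then show ?thesis by simp
qed

lemma time_step_pos: "stokes_setting Pb \<Longrightarrow> 0 < time_step Pb"
  unfolding stokes_setting_def time_step_def by simp

text \<open>Places the times at which the schemes sample the force, \<open>s = m\<close>,
  \<open>m + 1/2\<close> and \<open>m + 1\<close>, in the interval where the force vanishes.\<close>

lemma time_level_in_interval:
  assumes "stokes_setting Pb" and "0 \<le> s" and "s \<le> real (num_steps Pb)"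
  shows "s * time_step Pb \<in> {0..final_time Pb}"
proof -
  have "s * time_step Pb \<le> real (num_steps Pb) * time_step Pb"
    using assms time_step_pos[OF assms(1)] by (intro mult_right_mono) auto
  also have "\<dots> = final_time Pb"
    using assms(1) unfolding stokes_setting_def time_step_def by simp
  finally show ?thesis
    using assms time_step_pos[OF assms(1)] by simp
qed

text \<open>Common shape of the three energy equations: \<open>a\<close> is the energy difference,
  \<open>D\<close> the dissipation, \<open>F\<close> the work of the force. For BDF2 the divisor
  \<open>\<tau>\<close> is twice the time step.\<close>

lemma energy_balance_nonpos:
  fixes \<tau> :: real
  assumes "0 = a / \<tau> + D - F" and "0 < \<tau>" and "0 \<le> D" and "F = 0"
  shows "a \<le> 0"
proof -
  have "a / \<tau> \<le> 0" using assms by linarith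
  then show ?thesis using \<open>0 < \<tau>\<close> by (simp add: divide_le_0_iff)
qed

lemma step_energy_le:
  assumes set: "stokes_setting Pb" and m: "m < num_steps Pb"
    and f: "\<forall>t\<in>{0..final_time Pb}. \<forall>x\<in>closure (domain Pb). force Pb t x = 0"
  shows "euler_step Pb S m \<Longrightarrow> discrete_energy Pb S (Suc m) \<le> discrete_energy Pb S m"
    and "crank_nicolson_step Pb S m \<Longrightarrow> discrete_energy Pb S (Suc m) \<le> discrete_energy Pb S m"
    and "bdf2_step Pb S m \<Longrightarrow>
      3 * discrete_energy Pb S (Suc m) - 4 * discrete_energy Pb S m + discrete_energy Pb S (m - 1) \<le> 0"
proof -
  note \<tau> = time_step_pos[OF set] and D = dissipation_nonneg[OF set]
  have F: "l2_inner (domain Pb) u (interp_force Pb m (s * time_step Pb)) = 0"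
    if "0 \<le> s" "s \<le> real (num_steps Pb)" for s u
    using f time_level_in_interval[OF set that] by (intro l2_inner_interp_force_eq_0 set m) blast
  show "discrete_energy Pb S (Suc m) \<le> discrete_energy Pb S m" if "euler_step Pb S m"
    using that energy_balance_nonpos[OF _ \<tau> D F[of "real m"]] m
    unfolding euler_step_def Let_def by fastforce
  show "discrete_energy Pb S (Suc m) \<le> discrete_energy Pb S m" if "crank_nicolson_step Pb S m"
    using that energy_balance_nonpos[OF _ \<tau> D F[of "real m + 1/2"]] m
    unfolding crank_nicolson_step_def Let_def by fastforce
  show "3 * discrete_energy Pb S (Suc m) - 4 * discrete_energy Pb S m
      + discrete_energy Pb S (m - 1) \<le> 0" if "bdf2_step Pb S m"
  proof (rule energy_balance_nonpos[OF _ _ D F])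
    show "0 = (3 * discrete_energy Pb S (Suc m) - 4 * discrete_energy Pb S m
        + discrete_energy Pb S (m - 1)) / (2 * time_step Pb)
        + dissipation Pb m (predictor S m) (vel S (Suc m)) (vel S (Suc m))
        - l2_inner (domain Pb) (vel S (Suc m)) (interp_force Pb m (real (Suc m) * time_step Pb))"
      using that unfolding bdf2_step_def Let_def by blast
  \<comment> \<open>Remaining are positivity of the doubled time step and
    \<open>Suc m \<le> num_steps Pb\<close>, which holds with equality in the last step.\<close>
  qed (use m \<tau> in auto)
qed

lemma step_volume_eq:
  shows "euler_step Pb S m \<Longrightarrow> discrete_volume Pb S (Suc m) = discrete_volume Pb S m"
    and "crank_nicolson_step Pb S m \<Longrightarrow> discrete_volume Pb S (Suc m) = discrete_volume Pb S m"
    and "bdf2_step Pb S m \<Longrightarrow>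
      3 * discrete_volume Pb S (Suc m) - 4 * discrete_volume Pb S m + discrete_volume Pb S (m - 1) = 0"
  unfolding euler_step_def crank_nicolson_step_def bdf2_step_def Let_def by simp_all

text \<open>Treats all schemes uniformly. BDF2 starts with a one-step scheme, so a BDF2 step has
  \<open>0 < m\<close> and its \<open>m - 1\<close> is a true predecessor.\<close>

lemma scheme_solution_step_cases:
  assumes "scheme_solution sch Pb S" and "m < num_steps Pb"
  obtains "euler_step Pb S m" | "crank_nicolson_step Pb S m" | "0 < m" "bdf2_step Pb S m"
  using assms unfolding scheme_solution_def
  by (cases sch; cases "m = 0") auto

lemma scheme_solution_energy_le:
  assumes set: "stokes_setting Pb" and sol: "scheme_solution sch Pb S"
    and f: "\<forall>t\<in>{0..final_time Pb}. \<forall>x\<in>closure (domain Pb). force Pb t x = 0"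
    and m: "m < num_steps Pb"
  shows "discrete_energy Pb S (Suc m) \<le> discrete_energy Pb S m"
  using m
proof (induction m)
  case 0
  with sol show ?case
    \<comment> \<open>The BDF2 case contradicts \<open>0 < m\<close>.\<close>
    by (rule scheme_solution_step_cases) (use step_energy_le[OF set 0 f] in auto)
next
  case (Suc m)
  from sol Suc.prems show ?case
    by (rule scheme_solution_step_cases)
      \<comment> \<open>Only the BDF2 case uses the induction hypothesis: it bounds the previous
        energy increment by 0.\<close>
      (use step_energy_le[OF set Suc.prems f, of S] Suc in auto)
qed

lemma scheme_solution_volume_eq:
  assumes sol: "scheme_solution sch Pb S" and m: "m < num_steps Pb"
  shows "discrete_volume Pb S (Suc m) = discrete_volume Pb S m"
  using m
proof (induction m)
  case 0
  with sol show ?case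
    by (rule scheme_solution_step_cases) (use step_volume_eq[of Pb S 0] in auto)
next
  case (Suc m)
  from sol Suc.prems show ?case
    \<comment> \<open>In the BDF2 case the new volume increment is a third of the previous one,
      which is 0 by induction.\<close>
    by (rule scheme_solution_step_cases) (use step_volume_eq[of Pb S "Suc m"] Suc in auto)
qed

theorem theorem3p2:
  fixes Pb :: "('v, 'd::finite) stokes_problem"
    and S :: "('v, 'd) stokes_solution"
    and sch :: scheme
  assumes "stokes_setting Pb"
    and "\<forall>m\<le>num_steps Pb. polyhedral_surface (domain Pb) (surf_complex Pb) (nodes S m)"
    and "scheme_solution sch Pb S"
  shows "\<forall>m<num_steps Pb.
     ((\<forall>t\<in>{0..final_time Pb}. \<forall>x\<in>closure (domain Pb). force Pb t x = 0) \<longrightarrow>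
        (\<forall>j\<le>m. discrete_energy Pb S (Suc j) \<le> discrete_energy Pb S j)) \<and>
     (\<forall>j\<le>m. discrete_volume Pb S (Suc j) = discrete_volume Pb S j)"
  using scheme_solution_energy_le[OF assms(1,3)] scheme_solution_volume_eq[OF assms(3)]
  by (meson le_less_trans)

end
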